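(* Let $G=(G^0,G^1,\mathrm{s},\mathrm{t})$ be a directed graph, let $d:G^0\sqcup G^1\to\mathbb{N}\sqcup\{\infty\}$ be a function such that for each edge $e\in G^1$ we have $d(e)<\infty$ and $d(e)\le d(\mathrm{s}(e))$, and let $G_{\mathrm{od},d}$ be the out-delay of $G$ determined by $d$. For each category $\mathsf{C}$ there is an equivalence of categories $$\mathsf{Diag}^{\sqcup}_{\mathsf{C}}(G)\cong \mathsf{Diag}^{\sqcup}_{\mathsf{C}}(G_{\mathrm{od},d}).$$
   Context: A directed graph $G=(G^0,G^1,\mathrm{s},\mathrm{t})$ consists of a nonempty set $G^0$ of vertices, a set $G^1$ of edges, and source and target maps $\mathrm{s},\mathrm{t}:G^1\to G^0$ (no finiteness is assumed). A vertex $v$ is a source if $\mathrm{t}^{-1}(v)=\emptyset$. Here $\mathbb{N}=\{0,1,2,\dots\}$ and $n<\infty$ for all $n\in\mathbb{N}$. The out-delay $G_{\mathrm{od},d}=(G_{\mathrm{od},d}^0,G_{\mathrm{od},d}^1,\mathrm{s}_{\mathrm{od},d},\mathrm{t}_{\mathrm{od},d})$ is the directed graph with $G_{\mathrm{od},d}^0=\{(v,n)\mid v\in G^0,\ n\in\mathbb{N},\ 0\le n\le d(v)\}$, $G_{\mathrm{od},d}^1=G^1\sqcup\{e_{v,n}\mid v\in G^0,\ n\in\mathbb{N},\ 1\le n\le d(v)\}$, $\mathrm{s}_{\mathrm{od},d}(e)=(\mathrm{s}(e),d(e))$, $\mathrm{s}_{\mathrm{od},d}(e_{v,n})=(v,n-1)$,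 $\mathrm{t}_{\mathrm{od},d}(e)=(\mathrm{t}(e),0)$, $\mathrm{t}_{\mathrm{od},d}(e_{v,n})=(v,n)$. For a category $\mathsf{C}$, a diagram $D$ in $\mathsf{C}$ of shape $G$ consists of an object $D_v$ of $\mathsf{C}$ for each $v\in G^0$ and a morphism $D_e:D_{\mathrm{s}(e)}\to D_{\mathrm{t}(e)}$ for each $e\in G^1$. A morphism $T:D\to E$ consists of morphisms $T_v:D_v\to E_v$ ($v\in G^0$) with $T_{\mathrm{t}(e)}\circ D_e=E_e\circ T_{\mathrm{s}(e)}$ for all $e\in G^1$. The diagram $D$ satisfies the coproduct condition if for every vertex $v$ that is not a source, the family of morphisms $(D_e:D_{\mathrm{s}(e)}\to D_v\mid e\in \mathrm{t}^{-1}(v))$ makes $D_v$ a coproduct in $\mathsf{C}$ of the family $(D_{\mathrm{s}(e)}\mid e\in \mathrm{t}^{-1}(v))$ (this includes the requirement that such a coproduct exists). $\mathsf{Diag}^{\sqcup}_{\mathsf{C}}(G)$ is the category of diagrams in $\mathsf{C}$ of shape $G$ satisfying the coproduct condition, with all morphisms of diagrams between them. *)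

theory Defs
  imports
    "Graph_Theory.Digraph"
    "HOL-Library.FuncSet"
    "HOL-Library.Extended_Nat"
begin

section \<open>Categories\<close>

text \<open>\<open>Cmp C g f\<close> is the composite \<open>g \<circ> f\<close>. Outside the carriers the operations are unconstrained.\<close>

record ('o, 'm) cat_data =
  Ob :: "'o set"
  Ar :: "'m set"
  Dom :: "'m \<Rightarrow> 'o"
  Cod :: "'m \<Rightarrow> 'o"
  Ide :: "'o \<Rightarrow> 'm"
  Cmp :: "'m \<Rightarrow> 'm \<Rightarrow> 'm"

definition Hom :: "('o, 'm) cat_data \<Rightarrow> 'o \<Rightarrow> 'o \<Rightarrow> 'm set" where
  "Hom C a b = {f \<in> Ar C. Dom C f = a \<and> Cod C f = b}"

locale category =
  fixes C :: "('o, 'm) cat_data"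
  assumes Dom_in: "f \<in> Ar C \<Longrightarrow> Dom C f \<in> Ob C"
    and Cod_in: "f \<in> Ar C \<Longrightarrow> Cod C f \<in> Ob C"
    and Ide_in: "a \<in> Ob C \<Longrightarrow> Ide C a \<in> Hom C a a"
    and Cmp_in: "\<lbrakk>f \<in> Hom C a b; g \<in> Hom C b c\<rbrakk> \<Longrightarrow> Cmp C g f \<in> Hom C a c"
    and Ide_left: "f \<in> Hom C a b \<Longrightarrow> Cmp C (Ide C b) f = f"
    and Ide_right: "f \<in> Hom C a b \<Longrightarrow> Cmp C f (Ide C a) = f"
    and Cmp_assoc: "\<lbrakk>f \<in> Hom C a b; g \<in> Hom C b c; h \<in> Hom C c e\<rbrakk>
      \<Longrightarrow> Cmp C h (Cmp C g f) = Cmp C (Cmp C h g) f"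

definition is_iso :: "('o, 'm) cat_data \<Rightarrow> 'o \<Rightarrow> 'o \<Rightarrow> 'm \<Rightarrow> bool" where
  "is_iso C a b f \<longleftrightarrow> f \<in> Hom C a b \<and>
    (\<exists>g \<in> Hom C b a. Cmp C g f = Ide C a \<and> Cmp C f g = Ide C b)"

definition is_coproduct ::
  "('o, 'm) cat_data \<Rightarrow> 'i set \<Rightarrow> ('i \<Rightarrow> 'o) \<Rightarrow> 'o \<Rightarrow> ('i \<Rightarrow> 'm) \<Rightarrow> bool" where
  "is_coproduct C I X c \<iota> \<longleftrightarrow>
    c \<in> Ob C \<and> (\<forall>i\<in>I. X i \<in> Ob C \<and> \<iota> i \<in> Hom C (X i) c) \<and>
    (\<forall>y \<in> Ob C. \<forall>f. (\<forall>i\<in>I. f i \<in> Hom C (X i) y) \<longrightarrow>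
      (\<exists>!h. h \<in> Hom C c y \<and> (\<forall>i\<in>I. Cmp C h (\<iota> i) = f i)))"

section \<open>Functors, natural isomorphisms, equivalence\<close>

datatype ('o1, 'm1, 'o2, 'm2) fun_data =
  FunData (on_ob: "'o1 \<Rightarrow> 'o2") (on_ar: "'m1 \<Rightarrow> 'm2")

definition is_functor ::
  "('o1, 'm1) cat_data \<Rightarrow> ('o2, 'm2) cat_data \<Rightarrow> ('o1, 'm1, 'o2, 'm2) fun_data \<Rightarrow> bool" where
  "is_functor A B F \<longleftrightarrow>
    (\<forall>a \<in> Ob A. on_ob F a \<in> Ob B) \<and>
    (\<forall>a \<in> Ob A. \<forall>b \<in> Ob A. \<forall>f \<in> Hom A a b. on_ar F f \<in> Hom B (on_ob F a) (on_ob F b)) \<and>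
    (\<forall>a \<in> Ob A. on_ar F (Ide A a) = Ide B (on_ob F a)) \<and>
    (\<forall>a \<in> Ob A. \<forall>b \<in> Ob A. \<forall>c \<in> Ob A. \<forall>f \<in> Hom A a b. \<forall>g \<in> Hom A b c.
      on_ar F (Cmp A g f) = Cmp B (on_ar F g) (on_ar F f))"

definition id_fun :: "('o, 'm, 'o, 'm) fun_data" where
  "id_fun = FunData (\<lambda>a. a) (\<lambda>f. f)"

definition comp_fun ::
  "('o2, 'm2, 'o3, 'm3) fun_data \<Rightarrow> ('o1, 'm1, 'o2, 'm2) fun_data \<Rightarrow> ('o1, 'm1, 'o3, 'm3) fun_data" where
  "comp_fun G F = FunData (on_ob G \<circ> on_ob F) (on_ar G \<circ> on_ar F)"

definition is_nat_trans ::
  "('o1, 'm1) cat_data \<Rightarrow> ('o2, 'm2) cat_data \<Rightarrow> ('o1, 'm1, 'o2, 'm2) fun_data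
    \<Rightarrow> ('o1, 'm1, 'o2, 'm2) fun_data \<Rightarrow> ('o1 \<Rightarrow> 'm2) \<Rightarrow> bool" where
  "is_nat_trans A B F G \<eta> \<longleftrightarrow>
    (\<forall>a \<in> Ob A. \<eta> a \<in> Hom B (on_ob F a) (on_ob G a)) \<and>
    (\<forall>a \<in> Ob A. \<forall>b \<in> Ob A. \<forall>f \<in> Hom A a b.
      Cmp B (\<eta> b) (on_ar F f) = Cmp B (on_ar G f) (\<eta> a))"

definition naturally_isomorphic ::
  "('o1, 'm1) cat_data \<Rightarrow> ('o2, 'm2) cat_data \<Rightarrow> ('o1, 'm1, 'o2, 'm2) fun_data
    \<Rightarrow> ('o1, 'm1, 'o2, 'm2) fun_data \<Rightarrow> bool" where
  "naturally_isomorphic A B F G \<longleftrightarrow>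
    (\<exists>\<eta>. is_nat_trans A B F G \<eta> \<and> (\<forall>a \<in> Ob A. is_iso B (on_ob F a) (on_ob G a) (\<eta> a)))"

definition equivalent_categories :: "('o1, 'm1) cat_data \<Rightarrow> ('o2, 'm2) cat_data \<Rightarrow> bool" where
  "equivalent_categories A B \<longleftrightarrow> category A \<and> category B \<and>
    (\<exists>F G. is_functor A B F \<and> is_functor B A G \<and>
      naturally_isomorphic A A id_fun (comp_fun G F) \<and>
      naturally_isomorphic B B (comp_fun F G) id_fun)"

section \<open>Diagrams satisfying the coproduct condition\<close>

text \<open>Directed graphs are those of \<open>Graph_Theory\<close>; there \<open>tail\<close> is the source map \<open>s\<close> and
  \<open>head\<close> is the target map \<open>t\<close>, so that \<open>in_arcs G v\<close> is the fibre of \<open>t\<close> over \<open>v\<close>.\<close>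

definition is_source :: "('v, 'e) pre_digraph \<Rightarrow> 'v \<Rightarrow> bool" where
  "is_source G v \<longleftrightarrow> in_arcs G v = {}"

text \<open>Families indexed by the vertices or arcs are extensional functions (fixed to be
  \<open>undefined\<close> outside the index set), so that equality of diagrams and of their morphisms
  is equality of families.\<close>

datatype ('v, 'e, 'o, 'm) diagram = Diagram (vert_ob: "'v \<Rightarrow> 'o") (arc_mor: "'e \<Rightarrow> 'm")

definition is_diagram ::
  "('o, 'm) cat_data \<Rightarrow> ('v, 'e) pre_digraph \<Rightarrow> ('v, 'e, 'o, 'm) diagram \<Rightarrow> bool" where
  "is_diagram C G D \<longleftrightarrow>
    vert_ob D \<in> verts G \<rightarrow>\<^sub>E Ob C \<and>
    arc_mor D \<in> (\<Pi>\<^sub>E e \<in> arcs G. Hom C (vert_ob D (tail G e)) (vert_ob D (head G e)))"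

definition coproduct_condition ::
  "('o, 'm) cat_data \<Rightarrow> ('v, 'e) pre_digraph \<Rightarrow> ('v, 'e, 'o, 'm) diagram \<Rightarrow> bool" where
  "coproduct_condition C G D \<longleftrightarrow> (\<forall>v \<in> verts G. \<not> is_source G v \<longrightarrow>
    is_coproduct C (in_arcs G v) (\<lambda>e. vert_ob D (tail G e)) (vert_ob D v) (arc_mor D))"

definition diagram_morphisms ::
  "('o, 'm) cat_data \<Rightarrow> ('v, 'e) pre_digraph \<Rightarrow> ('v, 'e, 'o, 'm) diagram
    \<Rightarrow> ('v, 'e, 'o, 'm) diagram \<Rightarrow> ('v \<Rightarrow> 'm) set" where
  "diagram_morphisms C G D E =
    {T \<in> (\<Pi>\<^sub>E v \<in> verts G. Hom C (vert_ob D v) (vert_ob E v)).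
      \<forall>e \<in> arcs G. Cmp C (T (head G e)) (arc_mor D e) = Cmp C (arc_mor E e) (T (tail G e))}"

text \<open>An arrow of the diagram category carries its domain and codomain, because a family of
  components alone need not determine them (it does not determine the \<open>arc_mor\<close> parts).\<close>

datatype ('v, 'e, 'o, 'm) diagram_arrow =
  DiagramArrow (arrow_dom: "('v, 'e, 'o, 'm) diagram") (arrow_cod: "('v, 'e, 'o, 'm) diagram")
    (component: "'v \<Rightarrow> 'm")

definition Diag_coprod ::
  "('o, 'm) cat_data \<Rightarrow> ('v, 'e) pre_digraph
    \<Rightarrow> (('v, 'e, 'o, 'm) diagram, ('v, 'e, 'o, 'm) diagram_arrow) cat_data" where
  "Diag_coprod C G =
    (let Obs = {D. is_diagram C G D \<and> coproduct_condition C G D} in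
     \<lparr> Ob = Obs,
       Ar = {DiagramArrow D E T | D E T. D \<in> Obs \<and> E \<in> Obs \<and> T \<in> diagram_morphisms C G D E},
       Dom = arrow_dom,
       Cod = arrow_cod,
       Ide = (\<lambda>D. DiagramArrow D D (\<lambda>v \<in> verts G. Ide C (vert_ob D v))),
       Cmp = (\<lambda>S T. DiagramArrow (arrow_dom T) (arrow_cod S)
                (\<lambda>v \<in> verts G. Cmp C (component S v) (component T v))) \<rparr>)"

section \<open>The out-delay\<close>

text \<open>A delay function is defined on the disjoint union of vertices (\<open>Inl\<close>) and arcs (\<open>Inr\<close>).
  In the out-delay, \<open>Inl e\<close> is the arc \<open>e\<close> of \<open>G\<close> and \<open>Inr (v, n)\<close> is the new arc \<open>e_{v,n}\<close>.
  Delays of arcs of \<open>G\<close> are assumed finite wherever this is used, so \<open>the_enat\<close> is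
  their true value.\<close>

definition out_delay ::
  "('v, 'e) pre_digraph \<Rightarrow> ('v + 'e \<Rightarrow> enat) \<Rightarrow> ('v \<times> nat, 'e + 'v \<times> nat) pre_digraph" where
  "out_delay G d =
    \<lparr> verts = {(v, n) | v n. v \<in> verts G \<and> enat n \<le> d (Inl v)},
      arcs = Inl ` arcs G \<union> Inr ` {(v, n) | v n. v \<in> verts G \<and> 1 \<le> n \<and> enat n \<le> d (Inl v)},
      tail = case_sum (\<lambda>e. (tail G e, the_enat (d (Inr e)))) (\<lambda>(v, n). (v, n - 1)),
      head = case_sum (\<lambda>e. (head G e, 0)) (\<lambda>(v, n). (v, n)) \<rparr>"

end

theory Submission
  imports Defs
begin

text \<open>
  The out-delay replaces each vertex \<open>v\<close> by a path \<open>(v, 0) \<rightarrow> (v, 1) \<rightarrow> \<dots>\<close> of length \<open>d v\<close>. Old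
  arcs still arrive at \<open>(v, 0)\<close>, whereas each vertex \<open>(v, n)\<close> with \<open>n \<ge> 1\<close> receives exactly one
  arc, the new arc \<open>e\<^sub>v\<^sub>,\<^sub>n\<close>. A coproduct of a single object is an isomorphism, so the coproduct
  condition on the out-delay splits into two parts
  (\<open>coproduct_condition_delayed_iff\<close>): the new arcs carry isomorphisms, and the old arcs form
  coproduct cones over the objects at the delayed sources \<open>(s e, d e)\<close>. The paths of a diagram are
  thus redundant up to isomorphism, and this is the whole reason for the equivalence.

  Stretching a diagram on \<open>G\<close> puts the same object on the whole path of a vertex and identities
  on its new arcs. Collapsing a diagram \<open>E\<close> on the out-delay keeps the objects \<open>E(v, 0)\<close>; an old
  arc \<open>e\<close> now has to start at \<open>(s e, 0)\<close> instead of \<open>(s e, d e)\<close>, so its morphism is composed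
  with the composite of \<open>E\<close> along the initial segment of length \<open>d e\<close> of the path of \<open>s e\<close>. That
  composite is an isomorphism, and precomposing the legs of a coproduct with isomorphisms gives a
  coproduct again (\<open>is_coproduct_precompose_isos\<close>), so the coproduct condition survives.

  Stretching and then collapsing only composes with identities and returns the same diagram. In the
  other order the composites \<open>E(v, 0) \<rightarrow> E(v, n)\<close> along the paths are the components of a
  comparison morphism to \<open>E\<close>; it is natural because morphisms of diagrams commute with
  composites along paths (\<open>delay_path_natural\<close>), and it is an isomorphism because all its
  components are.
\<close>

section \<open>Isomorphisms and coproducts in a category\<close>

context category
begin

lemma Hom_obs: "f \<in> Hom C a b \<Longrightarrow> a \<in> Ob C" "f \<in> Hom C a b \<Longrightarrow> b \<in> Ob C"
  unfolding Hom_def using Dom_in Cod_in by auto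

lemma is_iso_Ide: "a \<in> Ob C \<Longrightarrow> is_iso C a a (Ide C a)"
  unfolding is_iso_def using Ide_in Ide_left by blast

lemma is_iso_Cmp:
  assumes "is_iso C a b f" "is_iso C b c g"
  shows "is_iso C a c (Cmp C g f)"
proof -
  obtain f' where f: "f \<in> Hom C a b" and f': "f' \<in> Hom C b a"
    and ff: "Cmp C f' f = Ide C a" "Cmp C f f' = Ide C b"
    using assms(1) unfolding is_iso_def by blast
  obtain g' where g: "g \<in> Hom C b c" and g': "g' \<in> Hom C c b"
    and gg: "Cmp C g' g = Ide C b" "Cmp C g g' = Ide C c"
    using assms(2) unfolding is_iso_def by blast
  have gf: "Cmp C g f \<in> Hom C a c" and fg: "Cmp C f' g' \<in> Hom C c a"
    using f g f' g' Cmp_in by blast+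
  have "Cmp C (Cmp C f' g') (Cmp C g f) = Cmp C f' (Cmp C g' (Cmp C g f))"
    using Cmp_assoc[OF gf g' f'] by simp
  also have "\<dots> = Ide C a"
    using Cmp_assoc[OF f g g'] gg Ide_left[OF f] ff by simp
  finally have 1: "Cmp C (Cmp C f' g') (Cmp C g f) = Ide C a" .
  have "Cmp C (Cmp C g f) (Cmp C f' g') = Cmp C g (Cmp C f (Cmp C f' g'))"
    using Cmp_assoc[OF fg f g] by simp
  also have "\<dots> = Ide C c"
    using Cmp_assoc[OF g' f' f] gg Ide_left[OF g'] ff by simp
  finally show ?thesis
    unfolding is_iso_def using gf fg 1 by blast
qed

text \<open>
  Extending the identity of \<open>X i\<close> along the single leg gives a left inverse of that leg; it is also
  a right inverse because the round trip from \<open>c\<close> and the identity of \<open>c\<close> both extend the leg itself,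
  and extensions are unique.
\<close>

lemma is_coproduct_singleton_iff_is_iso:
  "is_coproduct C {i} X c \<iota> \<longleftrightarrow> is_iso C (X i) c (\<iota> i)"
proof
  assume cop: "is_coproduct C {i} X c \<iota>"
  have c: "c \<in> Ob C" and X: "X i \<in> Ob C" and \<iota>: "\<iota> i \<in> Hom C (X i) c"
    using cop unfolding is_coproduct_def by auto
  have univ: "\<exists>!h. h \<in> Hom C c y \<and> Cmp C h (\<iota> i) = f"
    if "y \<in> Ob C" "f \<in> Hom C (X i) y" for y f
  proof -
    have "\<forall>f. (\<forall>j\<in>{i}. f j \<in> Hom C (X j) y) \<longrightarrow>
      (\<exists>!h. h \<in> Hom C c y \<and> (\<forall>j\<in>{i}. Cmp C h (\<iota> j) = f j))"
      using cop that(1) unfolding is_coproduct_def by blast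
    from spec[OF this, of "\<lambda>_. f"] show ?thesis using that(2) by simp
  qed
  obtain h where h: "h \<in> Hom C c (X i)" and h\<iota>: "Cmp C h (\<iota> i) = Ide C (X i)"
    using univ[OF X Ide_in[OF X]] by blast
  have "Cmp C (Cmp C (\<iota> i) h) (\<iota> i) = \<iota> i"
    using Cmp_assoc[OF \<iota> h \<iota>] h\<iota> Ide_right[OF \<iota>] by simp
  moreover have "Cmp C (\<iota> i) h \<in> Hom C c c" using Cmp_in[OF h \<iota>] .
  ultimately have "Cmp C (\<iota> i) h = Ide C c"
    using univ[OF c \<iota>] Ide_in[OF c] Ide_left[OF \<iota>] by blast
  then show "is_iso C (X i) c (\<iota> i)"
    unfolding is_iso_def using h h\<iota> \<iota> by blast
next
  assume "is_iso C (X i) c (\<iota> i)"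
  then obtain g where \<iota>: "\<iota> i \<in> Hom C (X i) c" and g: "g \<in> Hom C c (X i)"
    and g\<iota>: "Cmp C g (\<iota> i) = Ide C (X i)" and \<iota>g: "Cmp C (\<iota> i) g = Ide C c"
    unfolding is_iso_def by blast
  have "\<exists>!h. h \<in> Hom C c y \<and> Cmp C h (\<iota> i) = f"
    if f: "f \<in> Hom C (X i) y" for y f
  proof (rule ex1I[of _ "Cmp C f g"])
    show "Cmp C f g \<in> Hom C c y \<and> Cmp C (Cmp C f g) (\<iota> i) = f"
      using Cmp_in[OF g f] Cmp_assoc[OF \<iota> g f] g\<iota> Ide_right[OF f] by simp
  next
    fix h assume "h \<in> Hom C c y \<and> Cmp C h (\<iota> i) = f"
    then show "h = Cmp C f g"
      using Cmp_assoc[OF g \<iota>, of h y] \<iota>g Ide_right[of h c y] by auto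
  qed
  then show "is_coproduct C {i} X c \<iota>"
    unfolding is_coproduct_def using Hom_obs[OF \<iota>] \<iota> by simp
qed

text \<open>
  Composition with the isomorphisms translates cones on \<open>Y\<close> into cones on \<open>X\<close> bijectively, without
  changing which morphisms out of \<open>c\<close> mediate.
\<close>

lemma is_coproduct_precompose_isos:
  assumes cop: "is_coproduct C I X c \<iota>"
    and iso: "\<And>i. i \<in> I \<Longrightarrow> is_iso C (Y i) (X i) (\<phi> i)"
  shows "is_coproduct C I Y c (\<lambda>i. Cmp C (\<iota> i) (\<phi> i))"
proof -
  have \<iota>: "\<iota> i \<in> Hom C (X i) c" if "i \<in> I" for i
    using cop that unfolding is_coproduct_def by blast
  have c: "c \<in> Ob C" using cop unfolding is_coproduct_def by blast
  obtain \<psi> where \<phi>: "\<phi> i \<in> Hom C (Y i) (X i)" and \<psi>: "\<psi> i \<in> Hom C (X i) (Y i)"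
    and \<psi>\<phi>: "Cmp C (\<psi> i) (\<phi> i) = Ide C (Y i)" and \<phi>\<psi>: "Cmp C (\<phi> i) (\<psi> i) = Ide C (X i)"
    if "i \<in> I" for i
    using iso unfolding is_iso_def by metis
  have cone_iff: "Cmp C h (Cmp C (\<iota> i) (\<phi> i)) = k \<longleftrightarrow> Cmp C h (\<iota> i) = Cmp C k (\<psi> i)"
    if i: "i \<in> I" and h: "h \<in> Hom C c y" and k: "k \<in> Hom C (Y i) y" for h i y k
  proof -
    have h\<iota>: "Cmp C h (\<iota> i) \<in> Hom C (X i) y" using Cmp_in[OF \<iota>[OF i] h] .
    have *: "Cmp C h (Cmp C (\<iota> i) (\<phi> i)) = Cmp C (Cmp C h (\<iota> i)) (\<phi> i)"
      using Cmp_assoc[OF \<phi> \<iota> h] i by blast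
    have "Cmp C (Cmp C (Cmp C h (\<iota> i)) (\<phi> i)) (\<psi> i) = Cmp C h (\<iota> i)"
      using Cmp_assoc[OF \<psi> \<phi> h\<iota>] i \<phi>\<psi>[OF i] Ide_right[OF h\<iota>] by simp
    moreover have "Cmp C (Cmp C k (\<psi> i)) (\<phi> i) = k"
      using Cmp_assoc[OF \<phi> \<psi> k] i \<psi>\<phi>[OF i] Ide_right[OF k] by simp
    ultimately show ?thesis unfolding * by metis
  qed
  have "\<exists>!h. h \<in> Hom C c y \<and> (\<forall>i\<in>I. Cmp C h (Cmp C (\<iota> i) (\<phi> i)) = f i)"
    if y: "y \<in> Ob C" and f: "\<forall>i\<in>I. f i \<in> Hom C (Y i) y" for y f
  proof -
    have "\<forall>i\<in>I. Cmp C (f i) (\<psi> i) \<in> Hom C (X i) y"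
      using f \<psi> Cmp_in by blast
    moreover have "\<forall>g. (\<forall>i\<in>I. g i \<in> Hom C (X i) y) \<longrightarrow>
        (\<exists>!h. h \<in> Hom C c y \<and> (\<forall>i\<in>I. Cmp C h (\<iota> i) = g i))"
      using cop y unfolding is_coproduct_def by blast
    ultimately have "\<exists>!h. h \<in> Hom C c y \<and> (\<forall>i\<in>I. Cmp C h (\<iota> i) = Cmp C (f i) (\<psi> i))"
      by simp
    moreover have "(h \<in> Hom C c y \<and> (\<forall>i\<in>I. Cmp C h (Cmp C (\<iota> i) (\<phi> i)) = f i)) \<longleftrightarrow>
        (h \<in> Hom C c y \<and> (\<forall>i\<in>I. Cmp C h (\<iota> i) = Cmp C (f i) (\<psi> i)))" for h
      using cone_iff f by blast
    ultimately show ?thesis by simp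
  qed
  moreover have "Cmp C (\<iota> i) (\<phi> i) \<in> Hom C (Y i) c" if "i \<in> I" for i
    using Cmp_in[OF \<phi>[OF that] \<iota>[OF that]] .
  ultimately show ?thesis
    unfolding is_coproduct_def using c \<phi> Hom_obs by blast
qed

end

lemma is_coproduct_cong:
  assumes "\<And>i. i \<in> I \<Longrightarrow> X i = Y i" "\<And>i. i \<in> I \<Longrightarrow> \<iota> i = \<kappa> i"
  shows "is_coproduct C I X c \<iota> \<longleftrightarrow> is_coproduct C I Y c \<kappa>"
  using assms by (simp add: is_coproduct_def cong: ball_cong)

text \<open>
  The old arcs into \<open>(v, 0)\<close> are the tagged copies of the arcs into \<open>v\<close>, so a change of the type of
  indices is needed. A family on \<open>I\<close> is transported to the image of \<open>I\<close> by a partial inverse of \<open>g\<close>.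
\<close>

lemma is_coproduct_reindex:
  assumes inj: "inj_on g I"
  shows "is_coproduct C (g ` I) X c \<iota> \<longleftrightarrow> is_coproduct C I (X \<circ> g) c (\<iota> \<circ> g)"
proof -
  have "(\<forall>f. (\<forall>j\<in>g ` I. f j \<in> Hom C (X j) y) \<longrightarrow>
            (\<exists>!h. h \<in> Hom C c y \<and> (\<forall>j\<in>g ` I. Cmp C h (\<iota> j) = f j))) \<longleftrightarrow>
        (\<forall>f. (\<forall>i\<in>I. f i \<in> Hom C (X (g i)) y) \<longrightarrow>
            (\<exists>!h. h \<in> Hom C c y \<and> (\<forall>i\<in>I. Cmp C h (\<iota> (g i)) = f i)))"
    (is "?L \<longleftrightarrow> ?R") for y
  proof
    assume L: ?L
    show ?R
    proof (intro allI impI)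
      fix f assume "\<forall>i\<in>I. f i \<in> Hom C (X (g i)) y"
      then show "\<exists>!h. h \<in> Hom C c y \<and> (\<forall>i\<in>I. Cmp C h (\<iota> (g i)) = f i)"
        using L[THEN spec, of "f \<circ> inv_into I g"] inj by (simp cong: conj_cong ball_cong)
    qed
  next
    assume R: ?R
    show ?L
    proof (intro allI impI)
      fix f assume "\<forall>j\<in>g ` I. f j \<in> Hom C (X j) y"
      then show "\<exists>!h. h \<in> Hom C c y \<and> (\<forall>j\<in>g ` I. Cmp C h (\<iota> j) = f j)"
        using R[THEN spec, of "f \<circ> g"] by simp
    qed
  qed
  then show ?thesis by (simp add: is_coproduct_def)
qed

section \<open>The category of diagrams\<close>

lemma Ob_Diag: "Ob (Diag_coprod C G) = {D. is_diagram C G D \<and> coproduct_condition C G D}"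
  by (simp add: Diag_coprod_def)

lemma Ide_Diag:
  "Ide (Diag_coprod C G) D = DiagramArrow D D (\<lambda>v \<in> verts G. Ide C (vert_ob D v))"
  by (simp add: Diag_coprod_def)

lemma Cmp_Diag:
  "Cmp (Diag_coprod C G) (DiagramArrow E E' S) (DiagramArrow D D' T) =
    DiagramArrow D E' (\<lambda>v \<in> verts G. Cmp C (S v) (T v))"
  by (simp add: Diag_coprod_def)

lemma in_Hom_Diag_iff:
  "f \<in> Hom (Diag_coprod C G) D E \<longleftrightarrow>
    (\<exists>T. f = DiagramArrow D E T \<and> T \<in> diagram_morphisms C G D E \<and>
      D \<in> Ob (Diag_coprod C G) \<and> E \<in> Ob (Diag_coprod C G))"
  by (auto simp: Diag_coprod_def Hom_def)

lemma diagram_vert: "is_diagram C G D \<Longrightarrow> v \<in> verts G \<Longrightarrow> vert_ob D v \<in> Ob C"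
  by (auto simp: is_diagram_def)

lemma diagram_arc:
  "is_diagram C G D \<Longrightarrow> e \<in> arcs G \<Longrightarrow>
    arc_mor D e \<in> Hom C (vert_ob D (tail G e)) (vert_ob D (head G e))"
  by (auto simp: is_diagram_def)

lemma diagram_morphism_Hom:
  "T \<in> diagram_morphisms C G D E \<Longrightarrow> v \<in> verts G \<Longrightarrow> T v \<in> Hom C (vert_ob D v) (vert_ob E v)"
  by (auto simp: diagram_morphisms_def)

lemma diagram_morphism_square:
  "T \<in> diagram_morphisms C G D E \<Longrightarrow> e \<in> arcs G \<Longrightarrow>
    Cmp C (T (head G e)) (arc_mor D e) = Cmp C (arc_mor E e) (T (tail G e))"
  by (auto simp: diagram_morphisms_def)

lemma diagram_morphism_extensional:
  "T \<in> diagram_morphisms C G D E \<Longrightarrow> T \<in> extensional (verts G)"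
  by (auto simp: diagram_morphisms_def PiE_def)

context category
begin

lemma commuting_squares_paste:
  assumes f: "f \<in> Hom C a b" and f': "f' \<in> Hom C a' b'" and f'': "f'' \<in> Hom C a'' b''"
    and s: "s \<in> Hom C a a'" "s' \<in> Hom C a' a''" and t: "t \<in> Hom C b b'" "t' \<in> Hom C b' b''"
    and sq: "Cmp C t f = Cmp C f' s" "Cmp C t' f' = Cmp C f'' s'"
  shows "Cmp C (Cmp C t' t) f = Cmp C f'' (Cmp C s' s)"
proof -
  have "Cmp C (Cmp C t' t) f = Cmp C (Cmp C t' f') s"
    using Cmp_assoc[OF f t] Cmp_assoc[OF s(1) f' t(2)] sq(1) by simp
  also have "\<dots> = Cmp C f'' (Cmp C s' s)"
    using Cmp_assoc[OF s f''] sq(2) by simp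
  finally show ?thesis .
qed

lemma diagram_morphism_Cmp:
  assumes wf: "wf_digraph G"
    and D: "is_diagram C G D" "is_diagram C G D'" "is_diagram C G D''"
    and T: "T \<in> diagram_morphisms C G D D'" and S: "S \<in> diagram_morphisms C G D' D''"
  shows "(\<lambda>v \<in> verts G. Cmp C (S v) (T v)) \<in> diagram_morphisms C G D D''"
proof -
  interpret wf_digraph G by fact
  have "Cmp C (Cmp C (S (head G e)) (T (head G e))) (arc_mor D e) =
      Cmp C (arc_mor D'' e) (Cmp C (S (tail G e)) (T (tail G e)))" if e: "e \<in> arcs G" for e
    using e
    by (intro commuting_squares_paste[OF diagram_arc[OF D(1) e] diagram_arc[OF D(2) e]
          diagram_arc[OF D(3) e]] diagram_morphism_Hom[OF T] diagram_morphism_Hom[OF S]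
        diagram_morphism_square[OF T] diagram_morphism_square[OF S]) auto
  moreover have "Cmp C (S v) (T v) \<in> Hom C (vert_ob D v) (vert_ob D'' v)" if "v \<in> verts G" for v
    using that Cmp_in diagram_morphism_Hom[OF T] diagram_morphism_Hom[OF S] by blast
  ultimately show ?thesis by (simp add: diagram_morphisms_def)
qed

lemma diagram_morphism_Ide:
  assumes wf: "wf_digraph G" and D: "is_diagram C G D"
  shows "(\<lambda>v \<in> verts G. Ide C (vert_ob D v)) \<in> diagram_morphisms C G D D"
proof -
  interpret wf_digraph G by fact
  show ?thesis
    using Ide_in diagram_vert[OF D] Ide_left[OF diagram_arc[OF D]] Ide_right[OF diagram_arc[OF D]]
    by (simp add: diagram_morphisms_def)
qed

lemma category_Diag:
  assumes wf: "wf_digraph G"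
  shows "category (Diag_coprod C G)"
proof
  fix f assume "f \<in> Ar (Diag_coprod C G)"
  then show "Dom (Diag_coprod C G) f \<in> Ob (Diag_coprod C G)"
    and "Cod (Diag_coprod C G) f \<in> Ob (Diag_coprod C G)"
    by (auto simp: Diag_coprod_def)
next
  fix D assume "D \<in> Ob (Diag_coprod C G)"
  then show "Ide (Diag_coprod C G) D \<in> Hom (Diag_coprod C G) D D"
    using diagram_morphism_Ide[OF wf] by (simp add: in_Hom_Diag_iff Ide_Diag Ob_Diag)
next
  fix f g D D' D''
  assume "f \<in> Hom (Diag_coprod C G) D D'" "g \<in> Hom (Diag_coprod C G) D' D''"
  then show "Cmp (Diag_coprod C G) g f \<in> Hom (Diag_coprod C G) D D''"
    using diagram_morphism_Cmp[OF wf] by (auto simp: in_Hom_Diag_iff Cmp_Diag Ob_Diag)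
next
  fix f D E assume "f \<in> Hom (Diag_coprod C G) D E"
  then obtain T where f: "f = DiagramArrow D E T" and T: "T \<in> diagram_morphisms C G D E"
    by (auto simp: in_Hom_Diag_iff)
  show "Cmp (Diag_coprod C G) (Ide (Diag_coprod C G) E) f = f"
    and "Cmp (Diag_coprod C G) f (Ide (Diag_coprod C G) D) = f"
    using diagram_morphism_extensional[OF T] Ide_left[OF diagram_morphism_Hom[OF T]]
      Ide_right[OF diagram_morphism_Hom[OF T]]
    by (auto simp: f Ide_Diag Cmp_Diag extensional_def fun_eq_iff restrict_def)
next
  fix f g h D1 D2 D3 D4
  assume "f \<in> Hom (Diag_coprod C G) D1 D2" "g \<in> Hom (Diag_coprod C G) D2 D3"
    "h \<in> Hom (Diag_coprod C G) D3 D4"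
  then obtain R S T where f: "f = DiagramArrow D1 D2 R" "R \<in> diagram_morphisms C G D1 D2"
    and g: "g = DiagramArrow D2 D3 S" "S \<in> diagram_morphisms C G D2 D3"
    and h: "h = DiagramArrow D3 D4 T" "T \<in> diagram_morphisms C G D3 D4"
    by (auto simp: in_Hom_Diag_iff)
  have "Cmp C (T v) (Cmp C (S v) (R v)) = Cmp C (Cmp C (T v) (S v)) (R v)"
    if "v \<in> verts G" for v
    using that Cmp_assoc diagram_morphism_Hom[OF f(2)] diagram_morphism_Hom[OF g(2)]
      diagram_morphism_Hom[OF h(2)] by blast
  then show "Cmp (Diag_coprod C G) h (Cmp (Diag_coprod C G) g f) =
      Cmp (Diag_coprod C G) (Cmp (Diag_coprod C G) h g) f"
    by (auto simp: f g h Cmp_Diag cong: restrict_cong)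
qed

text \<open>
  The inverses of the components commute with the arcs automatically, because an isomorphism can be
  moved from one side of a commuting square to the other.
\<close>

lemma diagram_iso_if_componentwise_iso:
  assumes wf: "wf_digraph G"
    and D: "D \<in> Ob (Diag_coprod C G)" and E: "E \<in> Ob (Diag_coprod C G)"
    and T: "T \<in> diagram_morphisms C G D E"
    and iso: "\<And>v. v \<in> verts G \<Longrightarrow> is_iso C (vert_ob D v) (vert_ob E v) (T v)"
  shows "is_iso (Diag_coprod C G) D E (DiagramArrow D E T)"
proof -
  interpret wf_digraph G by fact
  have D': "is_diagram C G D" and E': "is_diagram C G E"
    using D E by (auto simp: Ob_Diag)
  obtain S where S: "S v \<in> Hom C (vert_ob E v) (vert_ob D v)"
    and ST: "Cmp C (S v) (T v) = Ide C (vert_ob D v)"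
    and TS: "Cmp C (T v) (S v) = Ide C (vert_ob E v)" if "v \<in> verts G" for v
    using iso unfolding is_iso_def by metis
  have "Cmp C (S (head G e)) (arc_mor E e) = Cmp C (arc_mor D e) (S (tail G e))"
    if e: "e \<in> arcs G" for e
  proof -
    let ?s = "tail G e" and ?t = "head G e"
    have v: "?s \<in> verts G" "?t \<in> verts G" using e by auto
    note De = diagram_arc[OF D' e] and Ee = diagram_arc[OF E' e]
    note Th = diagram_morphism_Hom[OF T]
    \<comment> \<open>Insert \<open>T \<circ> S = id\<close> on the right, then use the square of \<open>T\<close> to cancel \<open>S \<circ> T\<close> on the left.\<close>
    have SE: "Cmp C (S ?t) (arc_mor E e) \<in> Hom C (vert_ob E ?s) (vert_ob D ?t)"
      using Cmp_in[OF Ee S[OF v(2)]] .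
    have "Cmp C (S ?t) (arc_mor E e) = Cmp C (Cmp C (Cmp C (S ?t) (arc_mor E e)) (T ?s)) (S ?s)"
      using Cmp_assoc[OF S[OF v(1)] Th[OF v(1)] SE] TS[OF v(1)] Ide_right[OF SE] by simp
    also have "Cmp C (Cmp C (S ?t) (arc_mor E e)) (T ?s) = arc_mor D e"
      using Cmp_assoc[OF Th[OF v(1)] Ee S[OF v(2)]] diagram_morphism_square[OF T e]
        Cmp_assoc[OF De Th[OF v(2)] S[OF v(2)]] ST[OF v(2)] Ide_left[OF De] by simp
    finally show ?thesis .
  qed
  then have "restrict S (verts G) \<in> diagram_morphisms C G E D"
    using S by (simp add: diagram_morphisms_def)
  then have S_Hom: "DiagramArrow E D (restrict S (verts G)) \<in> Hom (Diag_coprod C G) E D"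
    using D E by (simp add: in_Hom_Diag_iff)
  show ?thesis
    unfolding is_iso_def
  proof (intro conjI bexI[OF _ S_Hom])
    show "DiagramArrow D E T \<in> Hom (Diag_coprod C G) D E"
      using T D E by (simp add: in_Hom_Diag_iff)
  qed (auto simp: Cmp_Diag Ide_Diag ST TS cong: restrict_cong)
qed

end

section \<open>The out-delay graph\<close>

text \<open>
  The bound on the delay of an arc \<open>e\<close> makes \<open>(s e, d e)\<close> a vertex, hence the out-delay well formed;
  finiteness makes \<open>d e\<close> a number of steps along a path.
\<close>

locale delayed_digraph = wf_digraph G + category C
  for G :: "('v, 'e) pre_digraph" and C :: "('o, 'm) cat_data" +
  fixes d :: "'v + 'e \<Rightarrow> enat"
  assumes arc_delay: "e \<in> arcs G \<Longrightarrow> d (Inr e) < \<infinity> \<and> d (Inr e) \<le> d (Inl (tail G e))"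
begin

abbreviation G\<^sub>d :: "('v \<times> nat, 'e + 'v \<times> nat) pre_digraph" where
  "G\<^sub>d \<equiv> out_delay G d"

abbreviation delay :: "'e \<Rightarrow> nat" where
  "delay e \<equiv> the_enat (d (Inr e))"

lemma vert_delayed: "(v, n) \<in> verts G\<^sub>d \<longleftrightarrow> v \<in> verts G \<and> enat n \<le> d (Inl v)"
  by (simp add: out_delay_def)

lemma vert_delayed_0: "v \<in> verts G \<Longrightarrow> (v, 0) \<in> verts G\<^sub>d"
  by (simp add: vert_delayed flip: zero_enat_def)

lemma vert_delayed_fst: "p \<in> verts G\<^sub>d \<Longrightarrow> fst p \<in> verts G"
  by (auto simp: out_delay_def)

lemma vert_delayed_Suc: "(v, Suc n) \<in> verts G\<^sub>d \<Longrightarrow> (v, n) \<in> verts G\<^sub>d"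
  unfolding vert_delayed by (meson Suc_ile_eq order_less_imp_le)

lemma vert_delayed_delay: "e \<in> arcs G \<Longrightarrow> (tail G e, delay e) \<in> verts G\<^sub>d"
  using arc_delay[of e] by (auto simp: vert_delayed)

lemma old_arc_delayed: "Inl e \<in> arcs G\<^sub>d \<longleftrightarrow> e \<in> arcs G"
  by (auto simp: out_delay_def)

lemma new_arc_delayed: "Inr (v, n) \<in> arcs G\<^sub>d \<longleftrightarrow> 1 \<le> n \<and> (v, n) \<in> verts G\<^sub>d"
  by (auto simp: out_delay_def)

lemma tail_head_delayed:
  "tail G\<^sub>d (Inl e) = (tail G e, delay e)" "head G\<^sub>d (Inl e) = (head G e, 0)"
  "tail G\<^sub>d (Inr (v, n)) = (v, n - 1)" "head G\<^sub>d (Inr (v, n)) = (v, n)"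
  by (simp_all add: out_delay_def)

lemma delayed_arc_cases [consumes 1, case_names old new]:
  assumes "a \<in> arcs G\<^sub>d"
  obtains e where "a = Inl e" "e \<in> arcs G"
  | v n where "a = Inr (v, Suc n)" "(v, Suc n) \<in> verts G\<^sub>d"
proof (cases a)
  case (Inl e)
  then show ?thesis using that(1) assms old_arc_delayed by blast
next
  case (Inr p)
  then obtain v n where "a = Inr (v, n)" by (cases p) auto
  then show ?thesis using that(2)[of v "n - 1"] assms new_arc_delayed[of v n] by simp
qed

lemma wf_delayed: "wf_digraph G\<^sub>d"
proof
  fix a assume "a \<in> arcs G\<^sub>d"
  then show "tail G\<^sub>d a \<in> verts G\<^sub>d" "head G\<^sub>d a \<in> verts G\<^sub>d"
    by (cases rule: delayed_arc_cases;
        simp add: tail_head_delayed vert_delayed_delay vert_delayed_0 vert_delayed_Suc)+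
qed

lemma in_arcs_delayed_0: "in_arcs G\<^sub>d (v, 0) = Inl ` in_arcs G v"
  by (auto simp: in_arcs_def tail_head_delayed old_arc_delayed elim!: delayed_arc_cases)

lemma in_arcs_delayed_Suc:
  "(v, Suc n) \<in> verts G\<^sub>d \<Longrightarrow> in_arcs G\<^sub>d (v, Suc n) = {Inr (v, Suc n)}"
  by (auto simp: in_arcs_def tail_head_delayed new_arc_delayed elim!: delayed_arc_cases)

text \<open>
  No vertex \<open>(v, Suc n)\<close> is a source, so the condition for new arcs is unconditional; \<open>(v, 0)\<close> is a
  source exactly when \<open>v\<close> is.
\<close>

lemma coproduct_condition_delayed_iff:
  "coproduct_condition C G\<^sub>d E \<longleftrightarrow>
    (\<forall>v \<in> verts G. \<not> is_source G v \<longrightarrow>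
      is_coproduct C (in_arcs G v) (\<lambda>e. vert_ob E (tail G e, delay e)) (vert_ob E (v, 0))
        (\<lambda>e. arc_mor E (Inl e))) \<and>
    (\<forall>v n. (v, Suc n) \<in> verts G\<^sub>d \<longrightarrow>
      is_iso C (vert_ob E (v, n)) (vert_ob E (v, Suc n)) (arc_mor E (Inr (v, Suc n))))"
    (is "_ \<longleftrightarrow> ?old \<and> ?new")
proof -
  have old: "(\<not> is_source G\<^sub>d (v, 0) \<longrightarrow> is_coproduct C (in_arcs G\<^sub>d (v, 0))
        (\<lambda>a. vert_ob E (tail G\<^sub>d a)) (vert_ob E (v, 0)) (arc_mor E)) \<longleftrightarrow>
      (\<not> is_source G v \<longrightarrow>
        is_coproduct C (in_arcs G v) (\<lambda>e. vert_ob E (tail G e, delay e)) (vert_ob E (v, 0))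
          (\<lambda>e. arc_mor E (Inl e)))" for v
    by (simp add: is_source_def in_arcs_delayed_0 is_coproduct_reindex comp_def tail_head_delayed)
  have new: "(\<not> is_source G\<^sub>d (v, Suc n) \<longrightarrow> is_coproduct C (in_arcs G\<^sub>d (v, Suc n))
        (\<lambda>a. vert_ob E (tail G\<^sub>d a)) (vert_ob E (v, Suc n)) (arc_mor E)) \<longleftrightarrow>
      is_iso C (vert_ob E (v, n)) (vert_ob E (v, Suc n)) (arc_mor E (Inr (v, Suc n)))"
    if "(v, Suc n) \<in> verts G\<^sub>d" for v n
    using that by (simp add: is_source_def in_arcs_delayed_Suc is_coproduct_singleton_iff_is_iso
        tail_head_delayed)
  show ?thesis
  proof
    assume E: "coproduct_condition C G\<^sub>d E"
    show "?old \<and> ?new"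
      using E old new vert_delayed_0 unfolding coproduct_condition_def by blast
  next
    assume E: "?old \<and> ?new"
    show "coproduct_condition C G\<^sub>d E"
      unfolding coproduct_condition_def
    proof
      fix p assume p: "p \<in> verts G\<^sub>d"
      obtain v n where "p = (v, n)" by (cases p)
      then show "\<not> is_source G\<^sub>d p \<longrightarrow> is_coproduct C (in_arcs G\<^sub>d p)
          (\<lambda>a. vert_ob E (tail G\<^sub>d a)) (vert_ob E p) (arc_mor E)"
        using E p old new vert_delayed by (cases n) auto
    qed
  qed
qed

section \<open>Stretching a diagram along the delays\<close>

definition stretch_diagram ::
  "('v, 'e, 'o, 'm) diagram \<Rightarrow> ('v \<times> nat, 'e + 'v \<times> nat, 'o, 'm) diagram" where
  "stretch_diagram D = Diagram (\<lambda>p \<in> verts G\<^sub>d. vert_ob D (fst p))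
    (\<lambda>a \<in> arcs G\<^sub>d. case a of Inl e \<Rightarrow> arc_mor D e | Inr p \<Rightarrow> Ide C (vert_ob D (fst p)))"

definition stretch ::
  "(('v, 'e, 'o, 'm) diagram, ('v, 'e, 'o, 'm) diagram_arrow,
    ('v \<times> nat, 'e + 'v \<times> nat, 'o, 'm) diagram,
    ('v \<times> nat, 'e + 'v \<times> nat, 'o, 'm) diagram_arrow) fun_data" where
  "stretch = FunData stretch_diagram
    (\<lambda>f. DiagramArrow (stretch_diagram (arrow_dom f)) (stretch_diagram (arrow_cod f))
      (\<lambda>p \<in> verts G\<^sub>d. component f (fst p)))"

lemma stretch_vert: "p \<in> verts G\<^sub>d \<Longrightarrow> vert_ob (stretch_diagram D) p = vert_ob D (fst p)"
  by (simp add: stretch_diagram_def)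

lemma stretch_old_arc: "e \<in> arcs G \<Longrightarrow> arc_mor (stretch_diagram D) (Inl e) = arc_mor D e"
  by (simp add: stretch_diagram_def old_arc_delayed)

lemma stretch_new_arc:
  "(v, Suc n) \<in> verts G\<^sub>d \<Longrightarrow>
    arc_mor (stretch_diagram D) (Inr (v, Suc n)) = Ide C (vert_ob D v)"
  by (simp add: stretch_diagram_def new_arc_delayed)

lemmas stretch_simps = stretch_vert stretch_old_arc stretch_new_arc

lemma stretch_Ob:
  assumes D: "D \<in> Ob (Diag_coprod C G)"
  shows "stretch_diagram D \<in> Ob (Diag_coprod C G\<^sub>d)"
proof -
  have D': "is_diagram C G D" and cop: "coproduct_condition C G D"
    using D by (auto simp: Ob_Diag)
  note obj = diagram_vert[OF D']
  have "arc_mor (stretch_diagram D) a \<in> Hom C (vert_ob (stretch_diagram D) (tail G\<^sub>d a))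
      (vert_ob (stretch_diagram D) (head G\<^sub>d a))" if "a \<in> arcs G\<^sub>d" for a
    using that
  proof (cases rule: delayed_arc_cases)
    case (old e)
    then show ?thesis
      using diagram_arc[OF D']
      by (simp add: tail_head_delayed stretch_simps vert_delayed_delay vert_delayed_0)
  next
    case (new v n)
    then show ?thesis
      using Ide_in[OF obj] vert_delayed_fst[OF new(2)]
      by (simp add: tail_head_delayed stretch_simps vert_delayed_Suc)
  qed
  then have "is_diagram C G\<^sub>d (stretch_diagram D)"
    using obj vert_delayed_fst
    by (simp add: is_diagram_def PiE_iff stretch_diagram_def)
  moreover have "coproduct_condition C G\<^sub>d (stretch_diagram D)"
    unfolding coproduct_condition_delayed_iff
  proof (intro conjI ballI allI impI)
    fix v assume v: "v \<in> verts G" "\<not> is_source G v"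
    have "is_coproduct C (in_arcs G v) (\<lambda>e. vert_ob D (tail G e)) (vert_ob D v) (arc_mor D)"
      using cop v unfolding coproduct_condition_def by blast
    then show "is_coproduct C (in_arcs G v)
        (\<lambda>e. vert_ob (stretch_diagram D) (tail G e, delay e))
        (vert_ob (stretch_diagram D) (v, 0)) (\<lambda>e. arc_mor (stretch_diagram D) (Inl e))"
      using v(1) by (subst is_coproduct_cong[where Y = "\<lambda>e. vert_ob D (tail G e)" and \<kappa> = "arc_mor D"])
        (auto simp: stretch_simps vert_delayed_delay vert_delayed_0)
  next
    fix v n assume v: "(v, Suc n) \<in> verts G\<^sub>d"
    then show "is_iso C (vert_ob (stretch_diagram D) (v, n))
        (vert_ob (stretch_diagram D) (v, Suc n)) (arc_mor (stretch_diagram D) (Inr (v, Suc n)))"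
      using is_iso_Ide[OF obj] vert_delayed_fst[OF v] by (simp add: stretch_simps vert_delayed_Suc)
  qed
  ultimately show ?thesis by (simp add: Ob_Diag)
qed

lemma stretch_morphism:
  assumes T: "T \<in> diagram_morphisms C G D E"
  shows "(\<lambda>p \<in> verts G\<^sub>d. T (fst p)) \<in>
    diagram_morphisms C G\<^sub>d (stretch_diagram D) (stretch_diagram E)"
proof -
  have "Cmp C ((\<lambda>p \<in> verts G\<^sub>d. T (fst p)) (head G\<^sub>d a)) (arc_mor (stretch_diagram D) a) =
      Cmp C (arc_mor (stretch_diagram E) a) ((\<lambda>p \<in> verts G\<^sub>d. T (fst p)) (tail G\<^sub>d a))"
    if "a \<in> arcs G\<^sub>d" for a
    using that
  proof (cases rule: delayed_arc_cases)
    case (old e)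
    then show ?thesis
      using diagram_morphism_square[OF T]
      by (simp add: tail_head_delayed stretch_simps vert_delayed_delay vert_delayed_0)
  next
    case (new v n)
    have Tv: "T v \<in> Hom C (vert_ob D v) (vert_ob E v)"
      using diagram_morphism_Hom[OF T] vert_delayed_fst[OF new(2)] by simp
    show ?thesis
      using new Ide_left[OF Tv] Ide_right[OF Tv]
      by (simp add: tail_head_delayed stretch_simps vert_delayed_Suc)
  qed
  moreover have "T (fst p) \<in> Hom C (vert_ob (stretch_diagram D) p) (vert_ob (stretch_diagram E) p)"
    if "p \<in> verts G\<^sub>d" for p
    using that diagram_morphism_Hom[OF T] vert_delayed_fst by (simp add: stretch_simps)
  ultimately show ?thesis
    unfolding diagram_morphisms_def by simp
qed

lemma stretch_functor: "is_functor (Diag_coprod C G) (Diag_coprod C G\<^sub>d) stretch"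
  unfolding is_functor_def
proof (intro conjI ballI)
  show "on_ob stretch D \<in> Ob (Diag_coprod C G\<^sub>d)" if "D \<in> Ob (Diag_coprod C G)" for D
    using stretch_Ob[OF that] by (simp add: stretch_def)
  show "on_ar stretch f \<in> Hom (Diag_coprod C G\<^sub>d) (on_ob stretch D) (on_ob stretch E)"
    if "f \<in> Hom (Diag_coprod C G) D E" for f D E
    using that stretch_Ob stretch_morphism by (auto simp: in_Hom_Diag_iff stretch_def)
  show "on_ar stretch (Ide (Diag_coprod C G) D) = Ide (Diag_coprod C G\<^sub>d) (on_ob stretch D)" for D
    by (auto simp: stretch_def Ide_Diag stretch_simps vert_delayed_fst cong: restrict_cong)
  show "on_ar stretch (Cmp (Diag_coprod C G) g f) =
      Cmp (Diag_coprod C G\<^sub>d) (on_ar stretch g) (on_ar stretch f)"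
    for f g
    by (cases f; cases g) (auto simp: stretch_def Cmp_Diag vert_delayed_fst cong: restrict_cong)
qed

section \<open>Collapsing a diagram on the out-delay\<close>

primrec delay_path ::
  "('v \<times> nat, 'e + 'v \<times> nat, 'o, 'm) diagram \<Rightarrow> 'v \<Rightarrow> nat \<Rightarrow> 'm" where
  "delay_path E v 0 = Ide C (vert_ob E (v, 0))"
| "delay_path E v (Suc n) = Cmp C (arc_mor E (Inr (v, Suc n))) (delay_path E v n)"

definition collapse_diagram ::
  "('v \<times> nat, 'e + 'v \<times> nat, 'o, 'm) diagram \<Rightarrow> ('v, 'e, 'o, 'm) diagram" where
  "collapse_diagram E = Diagram (\<lambda>v \<in> verts G. vert_ob E (v, 0))
    (\<lambda>e \<in> arcs G. Cmp C (arc_mor E (Inl e)) (delay_path E (tail G e) (delay e)))"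

definition collapse ::
  "(('v \<times> nat, 'e + 'v \<times> nat, 'o, 'm) diagram,
    ('v \<times> nat, 'e + 'v \<times> nat, 'o, 'm) diagram_arrow,
    ('v, 'e, 'o, 'm) diagram, ('v, 'e, 'o, 'm) diagram_arrow) fun_data" where
  "collapse = FunData collapse_diagram
    (\<lambda>f. DiagramArrow (collapse_diagram (arrow_dom f)) (collapse_diagram (arrow_cod f))
      (\<lambda>v \<in> verts G. component f (v, 0)))"

text \<open>Each step of the path is an isomorphism by the coproduct condition at its endpoint.\<close>

lemma delay_path_iso:
  assumes E: "E \<in> Ob (Diag_coprod C G\<^sub>d)"
  shows "(v, n) \<in> verts G\<^sub>d \<Longrightarrow> is_iso C (vert_ob E (v, 0)) (vert_ob E (v, n)) (delay_path E v n)"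
proof (induction n)
  case 0
  then show ?case
    using is_iso_Ide diagram_vert[of C G\<^sub>d E] E by (simp add: Ob_Diag)
next
  case (Suc n)
  have "is_iso C (vert_ob E (v, n)) (vert_ob E (v, Suc n)) (arc_mor E (Inr (v, Suc n)))"
    using E Suc.prems by (simp add: Ob_Diag coproduct_condition_delayed_iff)
  then show ?case
    using is_iso_Cmp Suc.IH[OF vert_delayed_Suc[OF Suc.prems]] by simp
qed

lemma delay_path_Hom:
  assumes "E \<in> Ob (Diag_coprod C G\<^sub>d)" "(v, n) \<in> verts G\<^sub>d"
  shows "delay_path E v n \<in> Hom C (vert_ob E (v, 0)) (vert_ob E (v, n))"
  using delay_path_iso[OF assms] by (simp add: is_iso_def)

text \<open>
  The naturality squares of \<open>T\<close> at the single new arcs paste to a square along the path. This lemma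
  serves twice: it makes collapsing functorial, and it is the naturality of the comparison.
\<close>

lemma delay_path_natural:
  assumes D: "D \<in> Ob (Diag_coprod C G\<^sub>d)" and E: "E \<in> Ob (Diag_coprod C G\<^sub>d)"
    and T: "T \<in> diagram_morphisms C G\<^sub>d D E"
  shows "(v, n) \<in> verts G\<^sub>d \<Longrightarrow>
    Cmp C (T (v, n)) (delay_path D v n) = Cmp C (delay_path E v n) (T (v, 0))"
proof (induction n)
  case 0
  then show ?case
    using Ide_left Ide_right diagram_morphism_Hom[OF T 0] by simp
next
  case (Suc n)
  note n = vert_delayed_Suc[OF Suc.prems]
  have v0: "(v, 0) \<in> verts G\<^sub>d" using vert_delayed_0 vert_delayed_fst[OF n] by simp
  have a: "Inr (v, Suc n) \<in> arcs G\<^sub>d" using Suc.prems by (simp add: new_arc_delayed)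
  have Da: "arc_mor D (Inr (v, Suc n)) \<in> Hom C (vert_ob D (v, n)) (vert_ob D (v, Suc n))"
    and Ea: "arc_mor E (Inr (v, Suc n)) \<in> Hom C (vert_ob E (v, n)) (vert_ob E (v, Suc n))"
    using D E diagram_arc[OF _ a] by (auto simp: Ob_Diag tail_head_delayed)
  have sq: "Cmp C (arc_mor E (Inr (v, Suc n))) (T (v, n)) =
      Cmp C (T (v, Suc n)) (arc_mor D (Inr (v, Suc n)))"
    using diagram_morphism_square[OF T a] by (simp add: tail_head_delayed)
  show ?case
    using commuting_squares_paste[OF diagram_morphism_Hom[OF T v0] diagram_morphism_Hom[OF T n]
        diagram_morphism_Hom[OF T Suc.prems] delay_path_Hom[OF D n] Da delay_path_Hom[OF E n] Ea
        Suc.IH[OF n, symmetric] sq] by simp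
qed

lemma collapse_vert: "v \<in> verts G \<Longrightarrow> vert_ob (collapse_diagram E) v = vert_ob E (v, 0)"
  by (simp add: collapse_diagram_def)

lemma collapse_arc:
  "e \<in> arcs G \<Longrightarrow> arc_mor (collapse_diagram E) e =
    Cmp C (arc_mor E (Inl e)) (delay_path E (tail G e) (delay e))"
  by (simp add: collapse_diagram_def)

lemma old_arc_Hom:
  assumes "E \<in> Ob (Diag_coprod C G\<^sub>d)" "e \<in> arcs G"
  shows "arc_mor E (Inl e) \<in> Hom C (vert_ob E (tail G e, delay e)) (vert_ob E (head G e, 0))"
  using assms diagram_arc[of C G\<^sub>d E "Inl e"]
  by (simp add: Ob_Diag tail_head_delayed old_arc_delayed)

lemma collapse_Ob:
  assumes E: "E \<in> Ob (Diag_coprod C G\<^sub>d)"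
  shows "collapse_diagram E \<in> Ob (Diag_coprod C G)"
proof -
  have "Cmp C (arc_mor E (Inl e)) (delay_path E (tail G e) (delay e))
      \<in> Hom C (vert_ob E (tail G e, 0)) (vert_ob E (head G e, 0))" if "e \<in> arcs G" for e
    using Cmp_in[OF delay_path_Hom[OF E vert_delayed_delay[OF that]] old_arc_Hom[OF E that]] .
  moreover have "vert_ob E (v, 0) \<in> Ob C" if "v \<in> verts G" for v
    using E that diagram_vert vert_delayed_0 by (fastforce simp: Ob_Diag)
  ultimately have "is_diagram C G (collapse_diagram E)"
    by (simp add: is_diagram_def PiE_iff collapse_diagram_def)
  moreover have "coproduct_condition C G (collapse_diagram E)"
    unfolding coproduct_condition_def
  proof (intro ballI impI)
    fix v assume v: "v \<in> verts G" "\<not> is_source G v"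
    have "is_coproduct C (in_arcs G v) (\<lambda>e. vert_ob E (tail G e, delay e)) (vert_ob E (v, 0))
        (\<lambda>e. arc_mor E (Inl e))"
      using E v by (simp add: Ob_Diag coproduct_condition_delayed_iff)
    then have "is_coproduct C (in_arcs G v) (\<lambda>e. vert_ob E (tail G e, 0)) (vert_ob E (v, 0))
        (\<lambda>e. Cmp C (arc_mor E (Inl e)) (delay_path E (tail G e) (delay e)))"
      by (rule is_coproduct_precompose_isos) (simp add: delay_path_iso[OF E] vert_delayed_delay)
    then show "is_coproduct C (in_arcs G v) (\<lambda>e. vert_ob (collapse_diagram E) (tail G e))
        (vert_ob (collapse_diagram E) v) (arc_mor (collapse_diagram E))"
      using v(1) by (subst is_coproduct_cong[where Y = "\<lambda>e. vert_ob E (tail G e, 0)"])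
        (auto simp: collapse_vert collapse_arc)
  qed
  ultimately show ?thesis by (simp add: Ob_Diag)
qed

lemma collapse_morphism:
  assumes D: "D \<in> Ob (Diag_coprod C G\<^sub>d)" and E: "E \<in> Ob (Diag_coprod C G\<^sub>d)"
    and T: "T \<in> diagram_morphisms C G\<^sub>d D E"
  shows "(\<lambda>v \<in> verts G. T (v, 0)) \<in>
    diagram_morphisms C G (collapse_diagram D) (collapse_diagram E)"
proof -
  note Th = diagram_morphism_Hom[OF T]
  have "Cmp C (T (head G e, 0)) (arc_mor (collapse_diagram D) e) =
      Cmp C (arc_mor (collapse_diagram E) e) (T (tail G e, 0))" if e: "e \<in> arcs G" for e
  proof -
    have v: "(tail G e, delay e) \<in> verts G\<^sub>d" "(tail G e, 0) \<in> verts G\<^sub>d" "(head G e, 0) \<in> verts G\<^sub>d"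
      using e vert_delayed_delay vert_delayed_0 by auto
    have "Cmp C (arc_mor E (Inl e)) (T (tail G e, delay e)) =
        Cmp C (T (head G e, 0)) (arc_mor D (Inl e))"
      using diagram_morphism_square[OF T, of "Inl e"] e
      by (simp add: tail_head_delayed old_arc_delayed)
    from commuting_squares_paste[OF Th[OF v(2)] Th[OF v(1)] Th[OF v(3)]
        delay_path_Hom[OF D v(1)] old_arc_Hom[OF D e] delay_path_Hom[OF E v(1)] old_arc_Hom[OF E e]
        delay_path_natural[OF D E T v(1), symmetric] this]
    show ?thesis using e by (simp add: collapse_arc)
  qed
  then show ?thesis
    using Th vert_delayed_0 by (simp add: diagram_morphisms_def collapse_vert)
qed

lemma collapse_functor: "is_functor (Diag_coprod C G\<^sub>d) (Diag_coprod C G) collapse"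
  unfolding is_functor_def
proof (intro conjI ballI)
  show "on_ob collapse D \<in> Ob (Diag_coprod C G)" if "D \<in> Ob (Diag_coprod C G\<^sub>d)" for D
    using collapse_Ob[OF that] by (simp add: collapse_def)
  show "on_ar collapse f \<in> Hom (Diag_coprod C G) (on_ob collapse D) (on_ob collapse E)"
    if "f \<in> Hom (Diag_coprod C G\<^sub>d) D E" for f D E
    using that collapse_Ob collapse_morphism by (auto simp: in_Hom_Diag_iff collapse_def)
  show "on_ar collapse (Ide (Diag_coprod C G\<^sub>d) D) = Ide (Diag_coprod C G) (on_ob collapse D)" for D
    by (auto simp: collapse_def Ide_Diag collapse_vert vert_delayed_0 cong: restrict_cong)
  show "on_ar collapse (Cmp (Diag_coprod C G\<^sub>d) g f) =
      Cmp (Diag_coprod C G) (on_ar collapse g) (on_ar collapse f)" for f g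
    by (cases f; cases g) (auto simp: collapse_def Cmp_Diag vert_delayed_0 cong: restrict_cong)
qed

section \<open>Unit and counit of the equivalence\<close>

lemma delay_path_stretch:
  assumes D: "is_diagram C G D"
  shows "(v, n) \<in> verts G\<^sub>d \<Longrightarrow> delay_path (stretch_diagram D) v n = Ide C (vert_ob D v)"
proof (induction n)
  case 0
  then show ?case by (simp add: stretch_simps)
next
  case (Suc n)
  have "vert_ob D v \<in> Ob C"
    using diagram_vert[OF D] vert_delayed_fst[OF Suc.prems] by simp
  then show ?case
    using Suc vert_delayed_Suc Ide_left[OF Ide_in] by (simp add: stretch_simps)
qed

text \<open>
  The result is the diagram itself and not only an isomorphic one, because families are extensional.
  The unit of the equivalence can therefore be the identity.
\<close>

lemma collapse_stretch_diagram:
  assumes D: "is_diagram C G D"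
  shows "collapse_diagram (stretch_diagram D) = D"
proof (rule diagram.expand, intro conjI)
  have "vert_ob D \<in> extensional (verts G)" "arc_mor D \<in> extensional (arcs G)"
    using D by (auto simp: is_diagram_def PiE_def)
  note ext = this[unfolded extensional_def]
  show "vert_ob (collapse_diagram (stretch_diagram D)) = vert_ob D"
    using ext by (auto simp: collapse_diagram_def stretch_simps vert_delayed_0)
  show "arc_mor (collapse_diagram (stretch_diagram D)) = arc_mor D"
    using ext Ide_right[OF diagram_arc[OF D]]
    by (auto simp: collapse_diagram_def stretch_simps delay_path_stretch[OF D] vert_delayed_delay)
qed

lemma collapse_stretch_arrow:
  assumes f: "f \<in> Hom (Diag_coprod C G) D E"
  shows "on_ar collapse (on_ar stretch f) = f"
proof -
  obtain T where f: "f = DiagramArrow D E T" and T: "T \<in> diagram_morphisms C G D E"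
    and DE: "is_diagram C G D" "is_diagram C G E"
    using f by (auto simp: in_Hom_Diag_iff Ob_Diag)
  have "(\<lambda>v \<in> verts G. (\<lambda>p \<in> verts G\<^sub>d. T (fst p)) (v, 0)) = T"
    using diagram_morphism_extensional[OF T] by (auto simp: vert_delayed_0 extensional_def)
  then show ?thesis
    by (simp add: f collapse_def stretch_def collapse_stretch_diagram DE)
qed

lemma unit_iso:
  "naturally_isomorphic (Diag_coprod C G) (Diag_coprod C G) id_fun (comp_fun collapse stretch)"
proof -
  interpret Diag: category "Diag_coprod C G"
    using category_Diag[OF wf_digraph_axioms] .
  have ob: "on_ob (comp_fun collapse stretch) D = D" if "D \<in> Ob (Diag_coprod C G)" for D
    using that collapse_stretch_diagram by (simp add: Ob_Diag comp_fun_def collapse_def stretch_def)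
  have ar: "on_ar (comp_fun collapse stretch) f = f" if "f \<in> Hom (Diag_coprod C G) D E" for f D E
    using collapse_stretch_arrow[OF that] by (simp add: comp_fun_def)
  show ?thesis
    unfolding naturally_isomorphic_def is_nat_trans_def
    by (rule exI[of _ "Ide (Diag_coprod C G)"])
      (simp add: ob ar id_fun_def Diag.Ide_in Diag.Ide_left Diag.Ide_right Diag.is_iso_Ide)
qed

definition comparison ::
  "('v \<times> nat, 'e + 'v \<times> nat, 'o, 'm) diagram \<Rightarrow> 'v \<times> nat \<Rightarrow> 'm" where
  "comparison E = (\<lambda>(v, n) \<in> verts G\<^sub>d. delay_path E v n)"

lemma stretch_collapse_vert:
  "(v, n) \<in> verts G\<^sub>d \<Longrightarrow> vert_ob (stretch_diagram (collapse_diagram E)) (v, n) = vert_ob E (v, 0)"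
  by (auto simp: stretch_simps collapse_vert dest: vert_delayed_fst)

text \<open>
  On an old arc, the comparison is an identity at the head, and at the tail it is the very path that
  collapsing composed with the arc. On a new arc, the square is the recursion equation of the path.
\<close>

lemma comparison_morphism:
  assumes E: "E \<in> Ob (Diag_coprod C G\<^sub>d)"
  shows "comparison E \<in> diagram_morphisms C G\<^sub>d (stretch_diagram (collapse_diagram E)) E"
proof -
  let ?SE = "stretch_diagram (collapse_diagram E)"
  have "Cmp C (comparison E (head G\<^sub>d a)) (arc_mor ?SE a) =
      Cmp C (arc_mor E a) (comparison E (tail G\<^sub>d a))" if "a \<in> arcs G\<^sub>d" for a
    using that
  proof (cases rule: delayed_arc_cases)
    case (old e)
    have "Cmp C (arc_mor E (Inl e)) (delay_path E (tail G e) (delay e))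
        \<in> Hom C (vert_ob E (tail G e, 0)) (vert_ob E (head G e, 0))"
      using Cmp_in[OF delay_path_Hom[OF E vert_delayed_delay[OF old(2)]] old_arc_Hom[OF E old(2)]] .
    then show ?thesis
      using old Ide_left
      by (simp add: comparison_def tail_head_delayed stretch_simps collapse_arc vert_delayed_delay
          vert_delayed_0)
  next
    case (new v n)
    have v: "v \<in> verts G" using vert_delayed_fst[OF new(2)] by simp
    show ?thesis
      using new v Ide_right[OF delay_path_Hom[OF E new(2)]] vert_delayed_Suc[OF new(2)]
      by (simp add: comparison_def tail_head_delayed stretch_simps collapse_vert
          del: delay_path.simps) simp
  qed
  moreover have "comparison E p \<in> Hom C (vert_ob ?SE p) (vert_ob E p)" if "p \<in> verts G\<^sub>d" for p
    using that delay_path_Hom[OF E]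
    by (cases p) (simp add: comparison_def stretch_collapse_vert)
  moreover have "comparison E \<in> extensional (verts G\<^sub>d)"
    by (simp add: comparison_def)
  ultimately show ?thesis by (simp add: diagram_morphisms_def PiE_iff)
qed

lemma counit_iso:
  "naturally_isomorphic (Diag_coprod C G\<^sub>d) (Diag_coprod C G\<^sub>d) (comp_fun stretch collapse) id_fun"
  unfolding naturally_isomorphic_def is_nat_trans_def
proof (intro exI[of _ "\<lambda>E. DiagramArrow (stretch_diagram (collapse_diagram E)) E (comparison E)"]
    conjI ballI)
  fix E assume E: "E \<in> Ob (Diag_coprod C G\<^sub>d)"
  have "is_iso C (vert_ob (stretch_diagram (collapse_diagram E)) p) (vert_ob E p) (comparison E p)"
    if "p \<in> verts G\<^sub>d" for p
    using that delay_path_iso[OF E]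
    by (cases p) (simp add: comparison_def stretch_collapse_vert)
  then have "is_iso (Diag_coprod C G\<^sub>d) (stretch_diagram (collapse_diagram E)) E
      (DiagramArrow (stretch_diagram (collapse_diagram E)) E (comparison E))"
    using diagram_iso_if_componentwise_iso[OF wf_delayed stretch_Ob[OF collapse_Ob[OF E]] E
        comparison_morphism[OF E]] by blast
  then show "is_iso (Diag_coprod C G\<^sub>d) (on_ob (comp_fun stretch collapse) E) (on_ob id_fun E)
      (DiagramArrow (stretch_diagram (collapse_diagram E)) E (comparison E))"
    by (simp add: comp_fun_def id_fun_def stretch_def collapse_def)
  then show "DiagramArrow (stretch_diagram (collapse_diagram E)) E (comparison E)
      \<in> Hom (Diag_coprod C G\<^sub>d) (on_ob (comp_fun stretch collapse) E) (on_ob id_fun E)"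
    unfolding is_iso_def by (rule conjunct1)
next
  fix D E f
  assume "D \<in> Ob (Diag_coprod C G\<^sub>d)" "E \<in> Ob (Diag_coprod C G\<^sub>d)"
    and "f \<in> Hom (Diag_coprod C G\<^sub>d) D E"
  then obtain T where D: "D \<in> Ob (Diag_coprod C G\<^sub>d)" and E: "E \<in> Ob (Diag_coprod C G\<^sub>d)"
    and f: "f = DiagramArrow D E T" and T: "T \<in> diagram_morphisms C G\<^sub>d D E"
    by (auto simp: in_Hom_Diag_iff)
  have "Cmp C (comparison E p) ((\<lambda>v \<in> verts G. T (v, 0)) (fst p)) = Cmp C (T p) (comparison D p)"
    if p: "p \<in> verts G\<^sub>d" for p
    using p delay_path_natural[OF D E T] vert_delayed_fst[OF p]
    by (cases p) (simp add: comparison_def)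
  then show "Cmp (Diag_coprod C G\<^sub>d)
        (DiagramArrow (stretch_diagram (collapse_diagram E)) E (comparison E))
        (on_ar (comp_fun stretch collapse) f) =
      Cmp (Diag_coprod C G\<^sub>d) (on_ar id_fun f)
        (DiagramArrow (stretch_diagram (collapse_diagram D)) D (comparison D))"
    by (simp add: f comp_fun_def id_fun_def stretch_def collapse_def Cmp_Diag cong: restrict_cong)
qed

lemma Diag_out_delay_equivalence:
  "equivalent_categories (Diag_coprod C G) (Diag_coprod C G\<^sub>d)"
  unfolding equivalent_categories_def
  using category_Diag[OF wf_digraph_axioms] category_Diag[OF wf_delayed]
    stretch_functor collapse_functor unit_iso counit_iso by blast

end

theorem theorem4p13:
  fixes G :: "('v, 'e) pre_digraph"
    and d :: "'v + 'e \<Rightarrow> enat"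
    and C :: "('o, 'm) cat_data"
  assumes "wf_digraph G"
    and "verts G \<noteq> {}"
    and "\<And>e. e \<in> arcs G \<Longrightarrow> d (Inr e) < \<infinity> \<and> d (Inr e) \<le> d (Inl (tail G e))"
    and "category C"
  shows "equivalent_categories (Diag_coprod C G) (Diag_coprod C (out_delay G d))"
proof -
  interpret delayed_digraph G C d
    using assms by (intro delayed_digraph.intro delayed_digraph_axioms.intro)
  show ?thesis by (rule Diag_out_delay_equivalence)
qed

end
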